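(* Consider the Engel group modelled on $\mathbb R^4$ as in the context, and $W=\{p\in\mathbb R^4:p_2=0\}$. There exist $X_2$-calibrated sets $E\subseteq\mathbb R^4$ such that, when $E$ is written as upper graph in the direction of $X_2$, i.e. $$E=\{w\cdot\exp(tX_2): w\in W,\ t>T(w)\}$$ with $T:W\to\mathbb R$, the function $T$ is not continuous.
   Context: The Engel group is $\mathbb R^4$ with the group law for which the vector fields $X_1=\partial_1$, $X_2=\partial_2+x_1\partial_3+\frac{x_1^2}{2}\partial_4$, $X_3=\partial_3+x_1\partial_4$, $X_4=\partial_4$ are left-invariant and the identity is $0$. One has $p\cdot\exp(tX_1)=(p_1+t,p_2,p_3,p_4)$ and $p\cdot\exp(tX_2)=(p_1,p_2+t,p_3+p_1t,p_4+p_1^2t/2)$. The set $W=\{p_2=0\}$ is a subgroup, and $(w,t)\mapsto w\exp(tX_2)$ is a bijection $W\times\mathbb R\to\mathbb R^4$. Continuity on $W\cong\mathbb R^3$ is with respect to the usual topology. An open set $E\subseteq\mathbb R^4$ is $X_2$-calibrated if: (i) $p\in E$ implies $p+(t,0,0,0)\in E$ for every $t\in\mathbb R$; (ii) for all $p\in\mathbb R^4$ there is $T\in[-\infty,+\infty]$ with $\{t\in\mathbb R:p+(0,t,p_1t,p_1^2t/2)\in E\}=(T,+\infty)$. *)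

theory Defs
  imports "HOL-Analysis.Analysis"
begin

lemma vector_4 [simp]:
  "(vector [a, b, c, d] :: ('a::zero)^4) $ 1 = a"
  "(vector [a, b, c, d] :: ('a::zero)^4) $ 2 = b"
  "(vector [a, b, c, d] :: ('a::zero)^4) $ 3 = c"
  "(vector [a, b, c, d] :: ('a::zero)^4) $ 4 = d"
  unfolding vector_def by simp_all

lemma vec4_eq_iff: "(p :: 'a^4) = q \<longleftrightarrow> p$1 = q$1 \<and> p$2 = q$2 \<and> p$3 = q$3 \<and> p$4 = q$4"
  by (simp add: vec_eq_iff forall_4)

section \<open>Vector fields and group law\<close>

definition X1 :: "real^4 \<Rightarrow> real^4" where
  "X1 p = vector [1, 0, 0, 0]"

definition X2 :: "real^4 \<Rightarrow> real^4" where
  "X2 p = vector [0, 1, p$1, (p$1)\<^sup>2 / 2]"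

definition X3 :: "real^4 \<Rightarrow> real^4" where
  "X3 p = vector [0, 0, 1, p$1]"

definition X4 :: "real^4 \<Rightarrow> real^4" where
  "X4 p = vector [0, 0, 0, 1]"

text \<open>The only operation with right neutral element \<open>0\<close> for which the four fields are
  left-invariant; see \<open>engel_group\<close>, \<open>left_invariant_X\<close> and \<open>engel_mult_unique\<close> below.\<close>

definition engel_mult :: "real^4 \<Rightarrow> real^4 \<Rightarrow> real^4" where
  "engel_mult p q = vector
     [p$1 + q$1,
      p$2 + q$2,
      p$3 + q$3 + p$1 * q$2,
      p$4 + q$4 + p$1 * q$3 + (p$1)\<^sup>2 / 2 * q$2]"

definition engel_inv :: "real^4 \<Rightarrow> real^4" where
  "engel_inv p = vector
     [- p$1, - p$2, - p$3 + p$1 * p$2, - p$4 + p$1 * p$3 - (p$1)\<^sup>2 / 2 * p$2]"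

definition left_invariant ::
  "(real^4 \<Rightarrow> real^4 \<Rightarrow> real^4) \<Rightarrow> (real^4 \<Rightarrow> real^4) \<Rightarrow> bool" where
  "left_invariant m X \<longleftrightarrow>
     (\<forall>p q. \<exists>D. (m p has_derivative D) (at q) \<and> D (X q) = X (m p q))"

text \<open>The value at time 1 of the integral curve of \<open>X\<close> issuing from the identity \<open>0\<close>.\<close>

definition field_exp :: "(real^4 \<Rightarrow> real^4) \<Rightarrow> real^4" where
  "field_exp X = (THE q. \<exists>\<gamma>. \<gamma> 0 = 0 \<and>
     (\<forall>s. (\<gamma> has_vector_derivative X (\<gamma> s)) (at s)) \<and> q = \<gamma> (1::real))"

definition W :: "(real^4) set" where
  "W = {p. p$2 = 0}"

section \<open>Calibrated sets and upper graphs\<close>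

definition X2_calibrated :: "(real^4) set \<Rightarrow> bool" where
  "X2_calibrated E \<longleftrightarrow>
     open E \<and>
     (\<forall>p\<in>E. \<forall>t. p + vector [t, 0, 0, 0] \<in> E) \<and>
     (\<forall>p. \<exists>T::ereal.
        {t. p + vector [0, t, p$1 * t, (p$1)\<^sup>2 * t / 2] \<in> E} = {t. T < ereal t})"

text \<open>A function on \<open>W\<close> is a total function of which only the values on \<open>W\<close> matter.\<close>

definition X2_upper_graph :: "(real^4 \<Rightarrow> real) \<Rightarrow> (real^4) set" where
  "X2_upper_graph T =
     {engel_mult w (field_exp (\<lambda>p. t *\<^sub>R X2 p)) | w t. w \<in> W \<and> T w < t}"

section \<open>Consistency of the definitions\<close>

lemma engel_group: "group engel_mult 0 engel_inv"
  by unfold_locales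
    (simp_all add: engel_mult_def engel_inv_def vec4_eq_iff algebra_simps power2_eq_square
      add_divide_distrib)

lemma W_subgroup:
  "0 \<in> W" "p \<in> W \<Longrightarrow> q \<in> W \<Longrightarrow> engel_mult p q \<in> W" "p \<in> W \<Longrightarrow> engel_inv p \<in> W"
  by (simp_all add: W_def engel_mult_def engel_inv_def)

lemma has_derivative_vec4I:
  fixes f :: "'b::real_normed_vector \<Rightarrow> real^4"
  assumes "((\<lambda>x. f x $ 1) has_derivative (\<lambda>h. D h $ 1)) F"
    "((\<lambda>x. f x $ 2) has_derivative (\<lambda>h. D h $ 2)) F"
    "((\<lambda>x. f x $ 3) has_derivative (\<lambda>h. D h $ 3)) F"
    "((\<lambda>x. f x $ 4) has_derivative (\<lambda>h. D h $ 4)) F"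
  shows "(f has_derivative D) F"
proof -
  have eq: "v = v$1 *\<^sub>R axis 1 1 + v$2 *\<^sub>R axis 2 1 + v$3 *\<^sub>R axis 3 1 + v$4 *\<^sub>R axis 4 1"
    for v :: "real^4"
    by (simp add: vec4_eq_iff axis_def)
  have "((\<lambda>x. f x $ 1 *\<^sub>R axis 1 1 + f x $ 2 *\<^sub>R axis 2 1 + f x $ 3 *\<^sub>R axis 3 1
          + f x $ 4 *\<^sub>R axis 4 1 :: real^4) has_derivative
        (\<lambda>h. D h $ 1 *\<^sub>R axis 1 1 + D h $ 2 *\<^sub>R axis 2 1 + D h $ 3 *\<^sub>R axis 3 1
          + D h $ 4 *\<^sub>R axis 4 1)) F"
    by (intro has_derivative_add has_derivative_scaleR_left assms)
  then show ?thesis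
    by (simp flip: eq)
qed

lemmas has_derivative_nth = bounded_linear_imp_has_derivative[OF bounded_linear_vec_nth]

definition engel_mult_deriv :: "real^4 \<Rightarrow> real^4 \<Rightarrow> real^4" where
  "engel_mult_deriv p h =
     vector [h$1, h$2, h$3 + p$1 * h$2, h$4 + p$1 * h$3 + (p$1)\<^sup>2 / 2 * h$2]"

lemma has_derivative_engel_mult: "(engel_mult p has_derivative engel_mult_deriv p) (at q)"
  by (rule has_derivative_vec4I)
    (auto simp: engel_mult_def engel_mult_deriv_def
      intro!: derivative_eq_intros has_derivative_nth)

lemma left_invariant_X:
  assumes "X \<in> {X1, X2, X3, X4}"
  shows "left_invariant engel_mult X"
proof -
  have "engel_mult_deriv p (X q) = X (engel_mult p q)" for p q
    using assms
    by (auto simp: engel_mult_deriv_def engel_mult_def X1_def X2_def X3_def X4_def vec4_eq_iff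
        power2_eq_square field_simps)
  then show ?thesis
    unfolding left_invariant_def using has_derivative_engel_mult by blast
qed

lemma engel_mult_unique:
  assumes inv: "\<And>X. X \<in> {X1, X2, X3, X4} \<Longrightarrow> left_invariant m X" and zero: "\<And>p. m p 0 = p"
  shows "m = engel_mult"
proof (intro ext)
  fix p q
  have "\<exists>D. (m p has_derivative D) (at x)" for x
    using inv[of X1] unfolding left_invariant_def by blast
  then obtain D where D: "(m p has_derivative D x) (at x)" for x
    by metis
  have DX: "D x (X x) = X (m p x)" if "X \<in> {X1, X2, X3, X4}" for X x
    using inv[OF that] D[of x] has_derivative_unique unfolding left_invariant_def by metis
  have Dh: "D x h = h$1 *\<^sub>R X1 (m p x) + h$2 *\<^sub>R X2 (m p x)
      + (h$3 - x$1 * h$2) *\<^sub>R X3 (m p x)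
      + (h$4 - x$1 * h$3 + (x$1)\<^sup>2 / 2 * h$2) *\<^sub>R X4 (m p x)" for x h
  proof -
    have lin: "linear (D x)"
      using D has_derivative_linear by blast
    have "h = h$1 *\<^sub>R X1 x + h$2 *\<^sub>R X2 x + (h$3 - x$1 * h$2) *\<^sub>R X3 x
      + (h$4 - x$1 * h$3 + (x$1)\<^sup>2 / 2 * h$2) *\<^sub>R X4 x"
      by (simp add: vec4_eq_iff X1_def X2_def X3_def X4_def power2_eq_square field_simps)
    then have "D x h = D x (h$1 *\<^sub>R X1 x + h$2 *\<^sub>R X2 x + (h$3 - x$1 * h$2) *\<^sub>R X3 x
      + (h$4 - x$1 * h$3 + (x$1)\<^sup>2 / 2 * h$2) *\<^sub>R X4 x)"
      by simp
    then show ?thesis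
      by (simp add: linear_add[OF lin] linear_scale[OF lin] DX)
  qed
  have "((\<lambda>x. m p x $ 1 - x $ 1) has_derivative (\<lambda>h. 0)) (at x)" for x
  proof -
    have "((\<lambda>x. m p x $ 1) has_derivative (\<lambda>h. D x h $ 1)) (at x)"
      using D bounded_linear.has_derivative[OF bounded_linear_vec_nth] by blast
    moreover have "D x h $ 1 = h $ 1" for h
      by (simp add: Dh X1_def X2_def X3_def X4_def)
    ultimately show ?thesis
      by (auto intro!: derivative_eq_intros has_derivative_nth)
  qed
  then have "m p x $ 1 - x $ 1 = m p 0 $ 1 - (0::real^4) $ 1" for x
    using has_derivative_zero_constant[of UNIV "\<lambda>x. m p x $ 1 - x $ 1"]
    by (metis UNIV_I convex_UNIV)
  then have m1: "m p x $ 1 = p $ 1 + x $ 1" for x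
    by (simp add: zero algebra_simps)
  have "D x = engel_mult_deriv p" for x
    by (rule ext) (simp add: Dh X1_def X2_def X3_def X4_def m1 engel_mult_deriv_def vec4_eq_iff
        power2_eq_square field_simps)
  then have "((\<lambda>x. m p x - engel_mult p x) has_derivative (\<lambda>h. 0)) (at x)" for x
    using has_derivative_diff[OF D[of x] has_derivative_engel_mult[of p x]] by simp
  then have "m p q - engel_mult p q = m p 0 - engel_mult p 0"
    using has_derivative_zero_constant[of UNIV "\<lambda>x. m p x - engel_mult p x"]
    by (metis UNIV_I convex_UNIV)
  also have "\<dots> = 0"
    by (simp add: zero engel_mult_def vec4_eq_iff)
  finally show "m p q = engel_mult p q"
    by simp
qed

lemma const_deriv_line:
  fixes f :: "real \<Rightarrow> real"
  assumes "\<And>s. (f has_real_derivative c) (at s)" and "f 0 = 0"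
  shows "f s = c * s"
proof -
  have "((\<lambda>s. f s - c * s) has_derivative (\<lambda>h. 0)) (at s)" for s
    using assms(1)[of s] unfolding has_field_derivative_def
    by (auto intro!: derivative_eq_intros)
  then have "f s - c * s = f 0 - c * 0"
    using has_derivative_zero_constant[of UNIV "\<lambda>s. f s - c * s"] by (metis UNIV_I convex_UNIV)
  then show ?thesis
    using assms(2) by simp
qed

lemma has_vector_derivative_nth:
  assumes "(\<gamma> has_vector_derivative (v :: real^4)) (at s)"
  shows "((\<lambda>s. \<gamma> s $ i) has_real_derivative v $ i) (at s)"
  using bounded_linear.has_vector_derivative[OF bounded_linear_vec_nth assms, of i]
  by (simp add: has_real_derivative_iff_has_vector_derivative)

lemma field_exp_X1: "field_exp (\<lambda>p. t *\<^sub>R X1 p) = vector [t, 0, 0, 0]"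
  unfolding field_exp_def
proof (rule the_equality)
  let ?g = "\<lambda>s. vector [s * t, 0, 0, 0] :: real^4"
  have "(?g has_vector_derivative t *\<^sub>R X1 (?g s)) (at s)" for s
    unfolding has_vector_derivative_def
    by (rule has_derivative_vec4I) (auto simp: X1_def intro!: derivative_eq_intros)
  then show "\<exists>\<gamma>. \<gamma> 0 = 0 \<and> (\<forall>s. (\<gamma> has_vector_derivative t *\<^sub>R X1 (\<gamma> s)) (at s)) \<and>
      vector [t, 0, 0, 0] = \<gamma> (1::real)"
    by (intro exI[of _ ?g]) (simp add: vec4_eq_iff)
next
  fix q
  assume "\<exists>\<gamma>. \<gamma> 0 = 0 \<and> (\<forall>s. (\<gamma> has_vector_derivative t *\<^sub>R X1 (\<gamma> s)) (at s)) \<and> q = \<gamma> (1::real)"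
  then obtain \<gamma> where 0: "\<gamma> 0 = 0" and q: "q = \<gamma> (1::real)"
    and d: "\<And>s. (\<gamma> has_vector_derivative t *\<^sub>R X1 (\<gamma> s)) (at s)"
    by blast
  have "\<gamma> s $ i = (t *\<^sub>R vector [1, 0, 0, 0] :: real^4) $ i * s" for s i
    by (rule const_deriv_line) (use has_vector_derivative_nth[OF d] 0 in \<open>simp_all add: X1_def\<close>)
  then show "q = vector [t, 0, 0, 0]"
    by (simp add: q vec4_eq_iff)
qed

lemma field_exp_X2: "field_exp (\<lambda>p. t *\<^sub>R X2 p) = vector [0, t, 0, 0]"
  unfolding field_exp_def
proof (rule the_equality)
  let ?g = "\<lambda>s. vector [0, s * t, 0, 0] :: real^4"
  have "(?g has_vector_derivative t *\<^sub>R X2 (?g s)) (at s)" for s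
    unfolding has_vector_derivative_def
    by (rule has_derivative_vec4I) (auto simp: X2_def intro!: derivative_eq_intros)
  then show "\<exists>\<gamma>. \<gamma> 0 = 0 \<and> (\<forall>s. (\<gamma> has_vector_derivative t *\<^sub>R X2 (\<gamma> s)) (at s)) \<and>
      vector [0, t, 0, 0] = \<gamma> (1::real)"
    by (intro exI[of _ ?g]) (simp add: vec4_eq_iff)
next
  fix q
  assume "\<exists>\<gamma>. \<gamma> 0 = 0 \<and> (\<forall>s. (\<gamma> has_vector_derivative t *\<^sub>R X2 (\<gamma> s)) (at s)) \<and> q = \<gamma> (1::real)"
  then obtain \<gamma> where 0: "\<gamma> 0 = 0" and q: "q = \<gamma> (1::real)"
    and d: "\<And>s. (\<gamma> has_vector_derivative t *\<^sub>R X2 (\<gamma> s)) (at s)"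
    by blast
  have 1: "\<gamma> s $ 1 = 0 * s" for s
    by (rule const_deriv_line) (use has_vector_derivative_nth[OF d, of 1] 0 in \<open>simp_all add: X2_def\<close>)
  have "\<gamma> s $ i = (t *\<^sub>R vector [0, 1, 0, 0] :: real^4) $ i * s" for s i
    by (rule const_deriv_line)
      (use has_vector_derivative_nth[OF d] 0 1 in \<open>simp_all add: X2_def\<close>)
  then show "q = vector [0, t, 0, 0]"
    by (simp add: q vec4_eq_iff)
qed

lemma engel_mult_field_exp_X1:
  "engel_mult p (field_exp (\<lambda>q. t *\<^sub>R X1 q)) = p + vector [t, 0, 0, 0]"
  by (simp add: field_exp_X1 engel_mult_def vec4_eq_iff)

lemma engel_mult_field_exp_X2:
  "engel_mult p (field_exp (\<lambda>q. t *\<^sub>R X2 q)) = p + vector [0, t, p$1 * t, (p$1)\<^sup>2 * t / 2]"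
  by (simp add: field_exp_X2 engel_mult_def vec4_eq_iff)

lemma bij_betw_W_X2:
  "bij_betw (\<lambda>(w, t). engel_mult w (field_exp (\<lambda>p. t *\<^sub>R X2 p))) (W \<times> UNIV) UNIV"
proof (rule bij_betw_byWitness[where f' = "\<lambda>p.
    (vector [p$1, 0, p$3 - p$1 * p$2, p$4 - (p$1)\<^sup>2 * p$2 / 2], p$2)"])
qed (auto simp: W_def engel_mult_field_exp_X2 vec4_eq_iff)

end

(* Invariance under X_1 reduces the problem to sets in the coordinates (p_2, p_3, p_4) whose
   intersections with all lines of direction (1, x, x^2/2) are upper rays.  Since 1 > 0 and
   x^2/2 \<ge> 0, every set increasing in p_2 and in p_4 has this property, e.g.
   {p_2 > 1} \<union> {p_2 > 0, p_4 > 0}.  Its boundary contains segments in the direction x = 0,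
   across which the height T jumps from 1 to 0. *)
theory Submission
  imports Defs
begin

definition step_set :: "(real^4) set" where
  "step_set = {p. p$2 > 1 \<or> p$2 > 0 \<and> p$4 > 0}"

text \<open>Entry time into \<open>step_set\<close> of the \<open>X2\<close>-line starting in
  \<open>W\<close> with \<open>p$1 = x\<close> and \<open>p$4 = u\<close>. For \<open>x = 0\<close>
  the fourth coordinate stays \<open>u\<close>; otherwise it turns positive after time
  \<open>- 2 * u / x\<^sup>2\<close>, which is clamped to [0, 1].\<close>

definition step_height :: "real \<Rightarrow> real \<Rightarrow> real" where
  "step_height x u =
     (if x = 0 then (if u > 0 then 0 else 1) else min 1 (max 0 (- 2 * u / x\<^sup>2)))"

lemma step_height_less_iff:
  "step_height x u < t \<longleftrightarrow> t > 1 \<or> t > 0 \<and> u + x\<^sup>2 * t / 2 > 0"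
proof (cases "x = 0")
  case False
  then have "x\<^sup>2 > 0" by simp
  then have "- 2 * u / x\<^sup>2 < t \<longleftrightarrow> - 2 * u < t * x\<^sup>2"
    by (rule pos_divide_less_eq)
  also have "\<dots> \<longleftrightarrow> u + x\<^sup>2 * t / 2 > 0"
    unfolding mult.commute[of t] by linarith
  finally have "- 2 * u / x\<^sup>2 < t \<longleftrightarrow> u + x\<^sup>2 * t / 2 > 0" .
  then show ?thesis
    using False by (simp add: step_height_def min_less_iff_disj)
qed (auto simp: step_height_def)

text \<open>Sliding \<open>p\<close> back along its \<open>X2\<close>-line for time
  \<open>p$2\<close> lands in \<open>W\<close> with fourth coordinate
  \<open>p$4 - (p$1)\<^sup>2 * p$2 / 2\<close>; measured from there, the time is
  \<open>p$2 + t\<close>.\<close>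

lemma line_mem_step_set_iff:
  "p + vector [0, t, p$1 * t, (p$1)\<^sup>2 * t / 2] \<in> step_set \<longleftrightarrow>
     step_height (p$1) (p$4 - (p$1)\<^sup>2 * p$2 / 2) < p$2 + t"
  by (simp add: step_set_def step_height_less_iff algebra_simps add_divide_distrib)

lemma open_step_set: "open step_set"
  unfolding step_set_def
  by (intro open_Collect_disj open_Collect_conj open_Collect_less continuous_intros)

lemma X2_calibrated_step_set: "X2_calibrated step_set"
  unfolding X2_calibrated_def
proof (intro conjI ballI allI open_step_set)
  fix p :: "real^4" and t :: real
  assume "p \<in> step_set"
  then show "p + vector [t, 0, 0, 0] \<in> step_set"
    by (simp add: step_set_def)
next
  fix p :: "real^4"
  show "\<exists>T::ereal.
      {t. p + vector [0, t, p$1 * t, (p$1)\<^sup>2 * t / 2] \<in> step_set} = {t. T < ereal t}"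
    by (intro exI[of _ "ereal (step_height (p$1) (p$4 - (p$1)\<^sup>2 * p$2 / 2) - p$2)"])
      (auto simp: line_mem_step_set_iff)
qed

text \<open>The line criterion at \<open>w \<in> W\<close>, where \<open>w$2 = 0\<close>, decides
  membership of every point, since the \<open>X2\<close>-lines from \<open>W\<close> fill the
  space.\<close>

lemma step_set_eq_upper_graph: "step_set = X2_upper_graph (\<lambda>w. step_height (w$1) (w$4))"
proof -
  have mem: "engel_mult w (field_exp (\<lambda>p. t *\<^sub>R X2 p)) \<in> step_set \<longleftrightarrow> step_height (w$1) (w$4) < t"
    if "w \<in> W" for w t
    using that by (simp add: engel_mult_field_exp_X2 line_mem_step_set_iff W_def)
  have surj: "p \<in> (\<lambda>(w, t). engel_mult w (field_exp (\<lambda>p. t *\<^sub>R X2 p))) ` (W \<times> UNIV)" for p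
    unfolding bij_betw_imp_surj_on[OF bij_betw_W_X2] by (rule UNIV_I)
  show ?thesis
  proof (intro set_eqI iffI)
    fix p
    assume p: "p \<in> step_set"
    obtain w t where "w \<in> W" and eq: "p = engel_mult w (field_exp (\<lambda>p. t *\<^sub>R X2 p))"
      using surj[of p] by (elim imageE SigmaE) (simp only: prod.case)
    moreover from this have "step_height (w$1) (w$4) < t"
      using p mem by simp
    ultimately show "p \<in> X2_upper_graph (\<lambda>w. step_height (w$1) (w$4))"
      unfolding X2_upper_graph_def by blast
  qed (auto simp: X2_upper_graph_def mem)
qed

lemma step_height_not_continuous: "\<not> continuous_on W (\<lambda>w. step_height (w$1) (w$4))"
proof
  assume cont: "continuous_on W (\<lambda>w. step_height (w$1) (w$4))"
  \<comment> \<open>These points approach the origin within \<open>x = 0\<close> and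
    \<open>u > 0\<close>, where the height is 0; at the origin it is 1.\<close>
  let ?w = "\<lambda>n. inverse (real (Suc n)) *\<^sub>R axis 4 1 :: real^4"
  have "?w \<longlonglongrightarrow> 0 *\<^sub>R axis 4 1"
    by (intro tendsto_scaleR LIMSEQ_inverse_real_of_nat tendsto_const)
  then have "?w \<longlonglongrightarrow> 0"
    by simp
  then have "(\<lambda>n. step_height (?w n $ 1) (?w n $ 4)) \<longlonglongrightarrow>
      step_height ((0::real^4)$1) ((0::real^4)$4)"
    by (rule continuous_on_tendsto_compose[OF cont]) (simp_all add: W_def axis_def)
  then have "(\<lambda>n. 0::real) \<longlonglongrightarrow> 1"
    by (simp add: step_height_def axis_def)
  then show False
    by (simp add: LIMSEQ_const_iff)
qed

theorem theorem4p1: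
  shows "\<exists>E. X2_calibrated E \<and>
    (\<exists>T. E = X2_upper_graph T \<and> \<not> continuous_on W T)"
  using X2_calibrated_step_set step_set_eq_upper_graph step_height_not_continuous by blast

end
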